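(* Fix an orthant $\mathcal O^{(r)}$ with sign matrix $J^{(r)}=\mathrm{diag}(j^{(r)}_{11},\dots,j^{(r)}_{nn})$, $j^{(r)}_{ii}\in\{-1,1\}$, and consider the dynamics $X(t+1)=A^{(r)}X(t)+b^{(r)}(X(t))$, $t=0,1,2,\dots$, where $X(0)\in\mathbb R^n_+$ and $x=J^{(r)}X(0)$ is in $\mathcal O^{(r)}$. (1) If $$(Dp)_i\le \big((\hat C^{-1}-C\hat C^{-1})\underline v\big)_i+\beta\quad\text{for all } i\in\mathcal N^{(r)},$$ $$(Dp)_i\ge \big((\hat C^{-1}-C\hat C^{-1})\underline v\big)_i\quad\text{for all } i\in\mathcal P^{(r)},$$ and $c_{il}=0$ for all $i,l\in N$ with $j^{(r)}_{ii}\ne j^{(r)}_{ll}$, then $$X(0)\ge 0\ \Longrightarrow\ X(t)\ge 0\quad\text{for all } t=0,1,2,\dots$$ (2) Similarly, if $$(Dp)_i\ge \big((\hat C^{-1}-C\hat C^{-1})\underline v\big)_i\quad\text{for all } i\in\mathcal P^{(r)},$$ and $c_{il}=0$ for all $i,l\in N$ with $i\in\mathcal P^{(r)}$, $l\in\mathcal N^{(r)}$, then for all $i\in\mathcal P^{(r)}$ $$X_i(0)\ge 0\ \Longrightarrow\ X_i(t)\ge 0\quad\text{for all } t=0,1,2,\dots$$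
   Context: Setting: $N=\{1,\dots,n\}$; $C=[c_{il}]\in\mathbb R^{n\times n}$ with $c_{il}\in[0,1]$, $c_{ii}=0$; $\hat c_{ii}:=1-\sum_{j\ne i}c_{ji}$, assumed $>0$ for every $i$; $\hat C:=\mathrm{diag}(\hat c_{11},\dots,\hat c_{nn})$; $D\in\mathbb R^{n\times m}$, $p\in\mathbb R^m$, $\underline v\in\mathbb R^n$ are given; $\beta\ge 0$ is a real number; $\mathbf 1$ is the all-ones vector; $I$ is the identity matrix. Vector inequalities are componentwise. The $2^n$ orthants of $\mathbb R^n$ are indexed by $r$. The diagonal matrix $J^{(r)}$ has $j^{(r)}_{ii}=-1$ if $x_i<0$ and $j^{(r)}_{ii}=1$ if $x_i\ge 0$, for a generic $x$ in the $r$-th orthant; the orthant is $\mathcal O^{(r)}:=\{x\in\mathbb R^n: J^{(r)}x\ge 0\}$. Put $\mathcal P^{(r)}:=\{i\in N: j^{(r)}_{ii}=1\}$ and $\mathcal N^{(r)}:=\{i\in N: j^{(r)}_{ii}=-1\}$. Failure term: $U(x)=[U_i(x)]_{i\in N}$ with $U_i(x)=\beta/2$ if $x_i<0$ and $U_i(x)=-\beta/2$ if $x_i\ge 0$. $A^{(r)}:=J^{(r)}\hat C C\hat C^{-1}J^{(r)}$ and, for $X\in\mathbb R^n$, $$b^{(r)}(X):=J^{(r)}\Big[(\hat C C\hat C^{-1}-I)\underline v+\hat C\big(Dp-U(J^{(r)}X)-\mathbf 1\tfrac{\beta}{2}\big)\Big].$$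
   Formalization: In (1), when β>0, X(t)≥0 is claimed only for those t such that no earlier X(s), s<t, has X_i(s)=0 for some i in N^(r); as printed, (1) fails there because U_i jumps to -β/2 at x_i=0 (n=1, C=0, J=-1, Dp=0, v=-1, β=2, X(0)=0 gives X(1)=-1). *)

theory Defs
  imports "HOL-Analysis.Analysis"
begin

definition diag_mat :: "real ^ 'n \<Rightarrow> real ^ 'n ^ 'n" where
  "diag_mat d = (\<chi> i l. if i = l then d $ i else 0)"

definition c_hat :: "real ^ 'n ^ 'n \<Rightarrow> real ^ 'n" where
  "c_hat C = (\<chi> i. 1 - (\<Sum>j\<in>UNIV - {i}. C $ j $ i))"

definition C_hat :: "real ^ 'n ^ 'n \<Rightarrow> real ^ 'n ^ 'n" where
  "C_hat C = diag_mat (c_hat C)"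

definition cross_holding :: "real ^ 'n ^ 'n \<Rightarrow> bool" where
  "cross_holding C \<longleftrightarrow>
     (\<forall>i l. 0 \<le> C $ i $ l \<and> C $ i $ l \<le> 1) \<and> (\<forall>i. C $ i $ i = 0) \<and> (\<forall>i. 0 < c_hat C $ i)"

text \<open>An orthant is represented by its sign matrix.\<close>

definition sign_matrix :: "real ^ 'n ^ 'n \<Rightarrow> bool" where
  "sign_matrix J \<longleftrightarrow> (\<exists>j. (\<forall>i. j $ i \<in> {-1, 1}) \<and> J = diag_mat j)"

definition orthant :: "real ^ 'n ^ 'n \<Rightarrow> (real ^ 'n) set" where
  "orthant J = {x. 0 \<le> J *v x}"

definition pos_idx :: "real ^ 'n ^ 'n \<Rightarrow> 'n set" where
  "pos_idx J = {i. J $ i $ i = 1}"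

definition neg_idx :: "real ^ 'n ^ 'n \<Rightarrow> 'n set" where
  "neg_idx J = {i. J $ i $ i = -1}"

text \<open>The failure term jumps at \<open>x $ i = 0\<close>, where it takes the value of the nonnegative side.
  So on the closed orthant of \<open>J\<close> it is not constant: on the faces \<open>x $ i = 0\<close> with
  \<open>i \<in> neg_idx J\<close> it differs from its value in the interior.\<close>

definition failure :: "real \<Rightarrow> real ^ 'n \<Rightarrow> real ^ 'n" where
  "failure \<beta> x = (\<chi> i. if x $ i < 0 then \<beta> / 2 else - (\<beta> / 2))"

definition A_orth :: "real ^ 'n ^ 'n \<Rightarrow> real ^ 'n ^ 'n \<Rightarrow> real ^ 'n ^ 'n" where
  "A_orth C J = J ** C_hat C ** C ** matrix_inv (C_hat C) ** J"

definition b_orth ::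
  "real ^ 'n ^ 'n \<Rightarrow> real ^ 'm ^ 'n \<Rightarrow> real ^ 'm \<Rightarrow> real ^ 'n \<Rightarrow> real
    \<Rightarrow> real ^ 'n ^ 'n \<Rightarrow> real ^ 'n \<Rightarrow> real ^ 'n" where
  "b_orth C D p v \<beta> J X =
     J *v ((C_hat C ** C ** matrix_inv (C_hat C) - mat 1) *v v
           + C_hat C *v (D *v p - failure \<beta> (J *v X) - (\<chi> i. \<beta> / 2)))"

end

theory Submission
  imports Defs
begin

text \<open>Both parts are inductions on time. The \<open>i\<close>-th entry of the shift is a positive multiple of
  \<open>j\<^sub>i ((Dp)\<^sub>i - w\<^sub>i - U\<^sub>i - \<beta>/2)\<close>, where \<open>w = (H\<^sup>-\<^sup>1 - C H\<^sup>-\<^sup>1) v\<close> and \<open>H = C_hat C\<close>. On a state in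
  the orthant the failure term \<open>U\<^sub>i\<close> is \<open>-\<beta>/2\<close> for \<open>j\<^sub>i = 1\<close> and \<open>\<beta>/2\<close> for \<open>j\<^sub>i = -1\<close> (off the face
  \<open>X\<^sub>i = 0\<close>), so the bounds on \<open>Dp\<close> say precisely that the shift is nonnegative. The vanishing
  cross-holdings remove the negative entries of \<open>A_orth\<close>.\<close>

lemma diag_mat_nth: "diag_mat d $ i $ l = (if i = l then d $ i else 0)"
  by (simp add: diag_mat_def)

lemma diag_mat_mult_left: "(diag_mat d ** M) $ i $ l = d $ i * M $ i $ l"
  by (simp add: matrix_matrix_mult_def diag_mat_nth if_distribR if_distrib[of "\<lambda>x. x * _"]
      cong: if_cong)

lemma diag_mat_mult_right: "(M ** diag_mat d) $ i $ l = M $ i $ l * d $ l"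
  by (simp add: matrix_matrix_mult_def diag_mat_nth if_distrib[of "\<lambda>x. _ * x"] cong: if_cong)

lemma diag_mat_mult_vec: "(diag_mat d *v x) $ i = d $ i * x $ i"
  by (simp add: matrix_vector_mult_def diag_mat_nth if_distrib[of "\<lambda>x. x * _"] cong: if_cong)

lemma matrix_inv_unique:
  fixes A :: "'a::semiring_1 ^ 'n ^ 'm"
  assumes "A ** B = mat 1" "B ** A = mat 1"
  shows "matrix_inv A = B"
proof -
  have "A ** matrix_inv A = mat 1 \<and> matrix_inv A ** A = mat 1"
    unfolding matrix_inv_def by (rule someI[of _ B]) (use assms in simp)
  then show ?thesis
    by (metis assms(2) matrix_mul_assoc matrix_mul_lid matrix_mul_rid)
qed

lemma matrix_inv_diag_mat:
  assumes "\<And>i. d $ i \<noteq> 0"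
  shows "matrix_inv (diag_mat d) = diag_mat (\<chi> i. inverse (d $ i))"
  using assms
  by (intro matrix_inv_unique) (auto simp: vec_eq_iff diag_mat_mult_left mat_def diag_mat_nth)

lemma A_orth_mult_vec:
  assumes "\<And>i. c_hat C $ i \<noteq> 0"
  shows "(A_orth C (diag_mat j) *v x) $ i =
    (\<Sum>l\<in>UNIV. j $ i * c_hat C $ i * C $ i $ l * inverse (c_hat C $ l) * j $ l * x $ l)"
  unfolding A_orth_def C_hat_def matrix_inv_diag_mat[OF assms] matrix_vector_mult_def
  \<comment> \<open>Products associate to the left, so the two right-hand diagonal factors come off
    first; reassociating then exposes the two on the left.\<close>
  by (simp add: diag_mat_mult_right) (simp add: diag_mat_mult_left mult.assoc flip: matrix_mul_assoc)

lemma b_orth_nth: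
  assumes "\<And>i. c_hat C $ i \<noteq> 0"
  shows "b_orth C D p v \<beta> (diag_mat j) x $ i = j $ i * c_hat C $ i *
    ((D *v p) $ i - ((matrix_inv (C_hat C) - C ** matrix_inv (C_hat C)) *v v) $ i
      - failure \<beta> (diag_mat j *v x) $ i - \<beta> / 2)"
proof -
  let ?H = "diag_mat (c_hat C)" and ?K = "diag_mat (\<chi> i. inverse (c_hat C $ i))"
  have K: "matrix_inv (C_hat C) = ?K"
    unfolding C_hat_def using matrix_inv_diag_mat[OF assms] .
  \<comment> \<open>As \<open>?H ** ?K\<close> is the identity, \<open>?H\<close> factors out on the
    left, so the \<open>v\<close> term acquires the same factor \<open>c_hat C $ i\<close> as the
    \<open>D *v p\<close> term.\<close>
  have "?H ** C ** ?K - mat 1 = ?H ** (C ** ?K - ?K)"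
    using assms
    by (auto simp: vec_eq_iff diag_mat_mult_left diag_mat_mult_right diag_mat_nth mat_def
        algebra_simps)
  then have v: "((?H ** C ** ?K - mat 1) *v v) $ i = - (c_hat C $ i * ((?K - C ** ?K) *v v) $ i)"
    by (simp add: matrix_vector_mult_diff_rdistrib diag_mat_mult_vec right_diff_distrib
        flip: matrix_vector_mul_assoc)
  show ?thesis
    unfolding b_orth_def K unfolding C_hat_def
    by (simp add: diag_mat_mult_vec v right_diff_distrib)
qed

text \<open>Only indices with a nonzero holding contribute, and there the two signs multiply to a
  square. The condition concerns row \<open>i\<close> alone, so it also serves part 2, where other
  entries of the state may be negative.\<close>

lemma A_orth_mult_vec_nonneg:
  assumes C: "cross_holding C"
    and x: "\<And>l. C $ i $ l \<noteq> 0 \<Longrightarrow> j $ l = j $ i \<and> 0 \<le> x $ l"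
  shows "0 \<le> (A_orth C (diag_mat j) *v x) $ i"
proof -
  have h: "0 < c_hat C $ l" and c: "0 \<le> C $ i $ l" for l
    using C by (auto simp: cross_holding_def)
  have "0 \<le> j $ i * c_hat C $ i * C $ i $ l * inverse (c_hat C $ l) * j $ l * x $ l" for l
  proof (cases "C $ i $ l = 0")
    case False
    then have "j $ i * c_hat C $ i * C $ i $ l * inverse (c_hat C $ l) * j $ l * x $ l
      = (j $ i * j $ i) * (c_hat C $ i * C $ i $ l * inverse (c_hat C $ l) * x $ l)"
      using x by simp
    also have "0 \<le> \<dots>"
      using x[OF False] h[of i] h[of l] c[of l] by (intro mult_nonneg_nonneg[OF zero_le_square]) simp
    finally show ?thesis .
  qed simp
  moreover have "c_hat C $ l \<noteq> 0" for l
    using h[of l] by simp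
  ultimately show ?thesis
    by (simp add: A_orth_mult_vec sum_nonneg)
qed

text \<open>The proviso on earlier states in part 1 comes from the jump of \<open>failure\<close>.
  If \<open>X s $ i = 0\<close> with \<open>i \<in> neg_idx J\<close>, the failure term is
  -\<beta>/2 and the shift is a positive multiple of w_i - (Dp)_i, which the bound (Dp)_i \<le> w_i
  + \<beta> allows to be negative when \<beta> > 0. For \<open>pos_idx J\<close> the value at zero
  is already the right one.\<close>

theorem theorem1:
  fixes C :: "real ^ 'n ^ 'n" and D :: "real ^ 'm ^ 'n" and p :: "real ^ 'm"
    and v :: "real ^ 'n" and \<beta> :: real and J :: "real ^ 'n ^ 'n"
    and X :: "nat \<Rightarrow> real ^ 'n"
  assumes "cross_holding C"
    and "0 \<le> \<beta>"
    and "sign_matrix J"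
    and "\<forall>t. X (Suc t) = A_orth C J *v X t + b_orth C D p v \<beta> J (X t)"
    and "0 \<le> X 0"
    and "J *v X 0 \<in> orthant J"
  shows
    "((\<forall>i\<in>neg_idx J. (D *v p) $ i \<le>
          ((matrix_inv (C_hat C) - C ** matrix_inv (C_hat C)) *v v) $ i + \<beta>) \<and>
      (\<forall>i\<in>pos_idx J. (D *v p) $ i \<ge>
          ((matrix_inv (C_hat C) - C ** matrix_inv (C_hat C)) *v v) $ i) \<and>
      (\<forall>i l. J $ i $ i \<noteq> J $ l $ l \<longrightarrow> C $ i $ l = 0)
      \<longrightarrow>
      (0 \<le> X 0 \<longrightarrow>
        (\<forall>t. (\<beta> > 0 \<longrightarrow> (\<forall>s<t. \<forall>i\<in>neg_idx J. X s $ i \<noteq> 0)) \<longrightarrow> 0 \<le> X t)))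
     \<and>
     ((\<forall>i\<in>pos_idx J. (D *v p) $ i \<ge>
          ((matrix_inv (C_hat C) - C ** matrix_inv (C_hat C)) *v v) $ i) \<and>
      (\<forall>i\<in>pos_idx J. \<forall>l\<in>neg_idx J. C $ i $ l = 0)
      \<longrightarrow>
      (\<forall>i\<in>pos_idx J. 0 \<le> X 0 $ i \<longrightarrow> (\<forall>t. 0 \<le> X t $ i)))"
proof -
  let ?w = "(matrix_inv (C_hat C) - C ** matrix_inv (C_hat C)) *v v"
  obtain j where j: "\<And>i. j $ i = -1 \<or> j $ i = 1" and J: "J = diag_mat j"
    using assms(3) by (auto simp: sign_matrix_def)
  have diag: "J $ i $ i = j $ i" for i
    by (simp add: J diag_mat_nth)
  have h: "0 < c_hat C $ i" for i
    using assms(1) by (simp add: cross_holding_def)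
  have h0: "c_hat C $ i \<noteq> 0" for i
    using h[of i] by simp
  have step: "X (Suc t) $ i = (A_orth C J *v X t) $ i + b_orth C D p v \<beta> J (X t) $ i" for t i
    using assms(4) by simp
  \<comment> \<open>Here U_i = -\<beta>/2 even at \<open>x $ i = 0\<close>, so -U_i and -\<beta>/2
    cancel.\<close>
  have b_pos: "0 \<le> b_orth C D p v \<beta> J x $ i"
    if "i \<in> pos_idx J" "?w $ i \<le> (D *v p) $ i" "0 \<le> x $ i" for x i
    using that h[of i]
    by (simp add: J b_orth_nth[OF h0] pos_idx_def diag[unfolded J] failure_def diag_mat_mult_vec)
  have b_neg: "0 \<le> b_orth C D p v \<beta> J x $ i"
    if i: "i \<in> neg_idx J" and D: "(D *v p) $ i \<le> ?w $ i + \<beta>"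
      and x: "0 \<le> x $ i" "\<beta> > 0 \<Longrightarrow> x $ i \<noteq> 0" for x i
  proof -
    have ji: "j $ i = -1"
      using i by (simp add: neg_idx_def diag)
    \<comment> \<open>For \<beta> = 0 both values of \<open>failure\<close> are 0; otherwise
      \<open>x $ i > 0\<close>, and the signed entry is strictly negative.\<close>
    have fail: "failure \<beta> (diag_mat j *v x) $ i = \<beta> / 2"
      using x assms(2) ji by (cases "\<beta> = 0") (auto simp: failure_def diag_mat_mult_vec)
    have "b_orth C D p v \<beta> J x $ i = c_hat C $ i * (?w $ i + \<beta> - (D *v p) $ i)"
      unfolding J b_orth_nth[OF h0] fail ji by (simp add: algebra_simps)
    then show ?thesis
      using h[of i] D by simp
  qed
  have part1: "0 \<le> X t"
    if neg: "\<forall>i\<in>neg_idx J. (D *v p) $ i \<le> ?w $ i + \<beta>"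
      and pos: "\<forall>i\<in>pos_idx J. (D *v p) $ i \<ge> ?w $ i"
      and zero: "\<forall>i l. J $ i $ i \<noteq> J $ l $ l \<longrightarrow> C $ i $ l = 0"
      and "\<beta> > 0 \<longrightarrow> (\<forall>s<t. \<forall>i\<in>neg_idx J. X s $ i \<noteq> 0)" for t
    using that(4)
  proof (induction t)
    case 0
    show ?case by (rule assms(5))
  next
    case (Suc t)
    then have X: "0 \<le> X t $ i" for i
      by (simp add: less_eq_vec_def)
    have "0 \<le> X (Suc t) $ i" for i
    proof -
      have "0 \<le> (A_orth C J *v X t) $ i"
        unfolding J using zero X by (intro A_orth_mult_vec_nonneg assms(1)) (metis diag)
      moreover have "0 \<le> b_orth C D p v \<beta> J (X t) $ i"
      proof (cases "i \<in> pos_idx J")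
        case True
        then show ?thesis using b_pos pos X by blast
      next
        case False
        then have "i \<in> neg_idx J"
          using j[of i] by (simp add: pos_idx_def neg_idx_def diag)
        \<comment> \<open>The proviso for \<open>Suc t\<close> includes time \<open>t\<close>
          itself, which keeps \<open>X t\<close> off the faces where \<open>failure\<close>
          jumps.\<close>
        then show ?thesis using b_neg neg X Suc.prems by blast
      qed
      ultimately show ?thesis by (simp add: step)
    qed
    then show ?case by (simp add: less_eq_vec_def)
  qed
  have part2: "\<forall>i\<in>pos_idx J. 0 \<le> X t $ i"
    if pos: "\<forall>i\<in>pos_idx J. (D *v p) $ i \<ge> ?w $ i"
      and zero: "\<forall>i\<in>pos_idx J. \<forall>l\<in>neg_idx J. C $ i $ l = 0" for t
  proof (induction t)
    case 0
    show ?case using assms(5) by (simp add: less_eq_vec_def)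
  next
    case (Suc t)
    show ?case
    proof
      fix i assume i: "i \<in> pos_idx J"
      \<comment> \<open>Rows in \<open>pos_idx J\<close> read only columns in
        \<open>pos_idx J\<close>, so the induction closes on these entries whatever the others
        do.\<close>
      have "l \<in> pos_idx J" if "C $ i $ l \<noteq> 0" for l
        using that zero i j[of l] by (auto simp: pos_idx_def neg_idx_def diag)
      then have "0 \<le> (A_orth C J *v X t) $ i"
        unfolding J using Suc.IH i
        by (intro A_orth_mult_vec_nonneg assms(1)) (auto simp: pos_idx_def diag diag_mat_nth)
      moreover have "0 \<le> b_orth C D p v \<beta> J (X t) $ i"
        using b_pos i pos Suc.IH by blast
      ultimately show "0 \<le> X (Suc t) $ i" by (simp add: step)
    qed
  qed
  show ?thesis
    using part1 part2 by blast
qed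

end
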